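(* Let $p,q,r$ be odd integers, let $P=|p|$, $Q=|q|$, $R=|r|$, and let $m\ge 1$ be an integer. Then $$N_0(p,q,r,m)=\begin{cases}0 & m\neq 2,\\ PQ+QR+PR & m=2,\end{cases}$$ $$N_1(p,q,r,m)=\begin{cases}0 & m>3,\\ P+Q+R & m=1,\\ 2(PQ+QR+PR) & m=2,\\ 3PQR+2\binom{P}{2}(Q+R)+2\binom{Q}{2}(P+R)+2\binom{R}{2}(P+Q) & m=3.\end{cases}$$
   Context: For $p,q,r\in\mathbb{Z}\setminus\{0\}$, $L(p,q,r)$ is the standard diagram of the three-column pretzel link: three vertical two-strand twist regions, being the 2-braids $\sigma^p,\sigma^q,\sigma^r$ (with $|p|,|q|,|r|$ crossings respectively), placed side by side, where neighbouring columns are joined at the top and at the bottom, and the outer strands of the first and last columns are joined at the top and at the bottom. It is a knot diagram iff at most one of $p,q,r$ is even. Choose either orientation of the knot. At a crossing, the oriented smoothing is the smoothing respecting the orientation of the knot, and the unoriented smoothing is the other smoothing. Crossings which are not chosen are not smoothed (the strands pass straight through). The number of components of the result is the number of closed immersed curves obtained. $N_0(p,q,r,m)$ is the number of ways to choose $m$ crossings of the diagram $L(p,q,r)$ such that performing the oriented smoothing at those $m$ crossings gives exactly one component. $N_1(p,q,r,m)$ is the number of ways to choose $m$ crossings together with smoothings at them such that exactly one has the unoriented smoothing, exactly $m-1$ have the oriented smoothing, and the result has exactly one component. (If $m$ exceeds the number of crossings, these numbers are $0$.) *)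

theory Defs
  imports Complex_Main
begin

section \<open>Link diagrams and their partial smoothings\<close>

text \<open>The four ends of the strands at a crossing, named by compass directions.\<close>

datatype corner = NW | NE | SW | SE

fun opposite :: "corner \<Rightarrow> corner" where
  "opposite NW = SE" | "opposite SE = NW" | "opposite NE = SW" | "opposite SW = NE"

fun vertical :: "corner \<Rightarrow> corner" where
  "vertical NW = SW" | "vertical SW = NW" | "vertical NE = SE" | "vertical SE = NE"

fun horizontal :: "corner \<Rightarrow> corner" where
  "horizontal NW = NE" | "horizontal NE = NW" | "horizontal SW = SE" | "horizontal SE = SW"

text \<open>
  A diagram is given as a combinatorial map. A pair of a crossing and a corner is an end
  of one of the strands through that crossing, and \<open>arc\<close> sends each such end to the other end of
  the diagram arc emanating from it. The field \<open>over_NW_SE\<close> tells whether the over-strand is the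
  one joining \<open>NW\<close> to \<open>SE\<close>; it does not enter the counts below.
\<close>

record 'x diagram =
  crossings :: "'x set"
  arc :: "'x \<times> corner \<Rightarrow> 'x \<times> corner"
  over_NW_SE :: "'x \<Rightarrow> bool"

definition ends :: "'x diagram \<Rightarrow> ('x \<times> corner) set" where
  "ends D = crossings D \<times> UNIV"

definition link_diagram :: "'x diagram \<Rightarrow> bool" where
  "link_diagram D \<longleftrightarrow> finite (crossings D) \<and>
     (\<forall>d\<in>ends D. arc D d \<in> ends D \<and> arc D d \<noteq> d \<and> arc D (arc D d) = d)"

text \<open>
  An orientation marks each end with \<open>True\<close> if the strand runs into the crossing there, and with
  \<open>False\<close> if it runs out of the crossing.
\<close>

definition orientation :: "'x diagram \<Rightarrow> ('x \<times> corner \<Rightarrow> bool) \<Rightarrow> bool" where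
  "orientation D ori \<longleftrightarrow>
     (\<forall>(x, c)\<in>ends D. ori (arc D (x, c)) \<noteq> ori (x, c) \<and> ori (x, opposite c) \<noteq> ori (x, c))"

definition coherent :: "('x \<times> corner \<Rightarrow> bool) \<Rightarrow> 'x \<Rightarrow> (corner \<Rightarrow> corner) \<Rightarrow> bool" where
  "coherent ori x f \<longleftrightarrow> (\<forall>c. ori (x, f c) \<noteq> ori (x, c))"

text \<open>Exactly one of the two smoothings of a crossing respects a given orientation.\<close>

lemma coherent_horizontal_iff:
  assumes "orientation D ori" and "x \<in> crossings D"
  shows "coherent ori x horizontal \<longleftrightarrow> \<not> coherent ori x vertical"
proof -
  have opp: "ori (x, opposite c) \<noteq> ori (x, c)" for c
    using assms by (auto simp: orientation_def ends_def)
  have all: "(\<forall>c. P c) \<longleftrightarrow> P NW \<and> P NE \<and> P SW \<and> P SE" for P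
    by (metis corner.exhaust)
  show ?thesis
    using opp[of NW] opp[of NE] by (auto simp: coherent_def all)
qed

datatype smoothing = Oriented | Unoriented

fun smooth :: "('x \<times> corner \<Rightarrow> bool) \<Rightarrow> 'x \<Rightarrow> smoothing \<Rightarrow> corner \<Rightarrow> corner" where
  "smooth ori x Oriented = (if coherent ori x vertical then vertical else horizontal)"
| "smooth ori x Unoriented = (if coherent ori x vertical then horizontal else vertical)"

text \<open>
  A choice of smoothings is a partial map on the crossings; at the crossings outside its domain
  the strands pass straight through.
\<close>

definition reconnect ::
  "('x \<times> corner \<Rightarrow> bool) \<Rightarrow> ('x \<rightharpoonup> smoothing) \<Rightarrow> 'x \<times> corner \<Rightarrow> 'x \<times> corner" where
  "reconnect ori s = (\<lambda>(x, c).
     (x, (case s x of None \<Rightarrow> opposite | Some t \<Rightarrow> smooth ori x t) c))"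

definition step ::
  "'x diagram \<Rightarrow> ('x \<times> corner \<Rightarrow> bool) \<Rightarrow> ('x \<rightharpoonup> smoothing) \<Rightarrow> (('x \<times> corner) \<times> ('x \<times> corner)) set" where
  "step D ori s = {(d, e). d \<in> ends D \<and> (e = arc D d \<or> e = reconnect ori s d)}"

text \<open>
  Both kinds of step are involutions on the ends, so the reflexive transitive closure is an
  equivalence relation. Its classes are the closed curves obtained by the smoothings.
\<close>

definition components :: "'x diagram \<Rightarrow> ('x \<times> corner \<Rightarrow> bool) \<Rightarrow> ('x \<rightharpoonup> smoothing) \<Rightarrow> nat" where
  "components D ori s = card (ends D // (step D ori s)\<^sup>*)"

definition N0 :: "'x diagram \<Rightarrow> ('x \<times> corner \<Rightarrow> bool) \<Rightarrow> nat \<Rightarrow> nat" where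
  "N0 D ori m = card {S. S \<subseteq> crossings D \<and> card S = m \<and>
     components D ori (\<lambda>x. if x \<in> S then Some Oriented else None) = 1}"

definition N1 :: "'x diagram \<Rightarrow> ('x \<times> corner \<Rightarrow> bool) \<Rightarrow> nat \<Rightarrow> nat" where
  "N1 D ori m = card {s. dom s \<subseteq> crossings D \<and> card (dom s) = m \<and>
     card {x. s x = Some Unoriented} = 1 \<and> card {x. s x = Some Oriented} = m - 1 \<and>
     components D ori s = 1}"

section \<open>Three-column pretzel diagrams\<close>

text \<open>
  Crossing \<open>(i, k)\<close> is the \<open>k\<close>-th one from the top in column \<open>i\<close>. Taking columns modulo 3 makes
  the arcs joining the outer strands of the first and last columns instances of the arcs joining
  neighbouring columns.
  A positive exponent is taken to mean crossings whose over-strand joins \<open>NW\<close> to \<open>SE\<close>.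
\<close>

definition twist :: "int \<Rightarrow> int \<Rightarrow> int \<Rightarrow> nat \<Rightarrow> int" where
  "twist p q r i = [p, q, r] ! i"

definition height :: "int \<Rightarrow> int \<Rightarrow> int \<Rightarrow> nat \<Rightarrow> nat" where
  "height p q r i = nat \<bar>twist p q r i\<bar>"

fun pretzel_arc :: "(nat \<Rightarrow> nat) \<Rightarrow> (nat \<times> nat) \<times> corner \<Rightarrow> (nat \<times> nat) \<times> corner" where
  "pretzel_arc h ((i, k), NW) =
     (if k = 0 then (((i + 2) mod 3, 0), NE) else ((i, k - 1), SW))"
| "pretzel_arc h ((i, k), NE) =
     (if k = 0 then (((i + 1) mod 3, 0), NW) else ((i, k - 1), SE))"
| "pretzel_arc h ((i, k), SW) =
     (if k + 1 = h i then (((i + 2) mod 3, h ((i + 2) mod 3) - 1), SE) else ((i, k + 1), NW))"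
| "pretzel_arc h ((i, k), SE) =
     (if k + 1 = h i then (((i + 1) mod 3, h ((i + 1) mod 3) - 1), SW) else ((i, k + 1), NE))"

definition pretzel :: "int \<Rightarrow> int \<Rightarrow> int \<Rightarrow> (nat \<times> nat) diagram" where
  "pretzel p q r =
     \<lparr>crossings = {(i, k). i < 3 \<and> k < height p q r i},
      arc = pretzel_arc (height p q r),
      over_NW_SE = (\<lambda>(i, k). twist p q r i > 0)\<rparr>"

lemma link_diagram_pretzel:
  assumes "p \<noteq> 0" and "q \<noteq> 0" and "r \<noteq> 0"
  shows "link_diagram (pretzel p q r)"
proof -
  let ?h = "height p q r"
  have h: "0 < ?h 0" "0 < ?h (Suc 0)" "0 < ?h 2"
    using assms by (auto simp: height_def twist_def)
  have "{(i, k). i < 3 \<and> k < ?h i} = Sigma {..<3} (\<lambda>i. {..<?h i})"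
    by auto
  then have fin: "finite {(i, k). i < 3 \<and> k < ?h i}"
    by simp
  have "pretzel_arc ?h d \<in> ends (pretzel p q r) \<and> pretzel_arc ?h d \<noteq> d \<and>
      pretzel_arc ?h (pretzel_arc ?h d) = d" if d: "d \<in> ends (pretzel p q r)" for d
  proof -
    obtain i k c where d_eq: "d = ((i, k), c)"
      by (metis surj_pair)
    have ik: "i < 3" "k < ?h i"
      using d by (auto simp: d_eq ends_def pretzel_def)
    have "i = 0 \<or> i = Suc 0 \<or> i = 2"
      using ik by linarith
    then show ?thesis
      using ik h
      by (cases c) (auto simp: d_eq ends_def pretzel_def simp flip: numeral_2_eq_2)
  qed
  with fin show ?thesis
    by (simp add: link_diagram_def pretzel_def)
qed

text \<open>
  For odd parameters the two strands of every column are antiparallel.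
\<close>

lemma orientation_pretzel_odd:
  assumes "odd p" and "odd q" and "odd r"
  shows "orientation (pretzel p q r) (\<lambda>((i, k), c). even k \<longleftrightarrow> c = NW \<or> c = SW)"
    (is "orientation _ ?o")
proof -
  let ?h = "height p q r"
  have h: "odd (?h i)" if "i < 3" for i
  proof -
    have "i = 0 \<or> i = Suc 0 \<or> i = 2"
      using that by linarith
    then show ?thesis
      using assms by (auto simp: height_def twist_def even_nat_iff)
  qed
  have h': "odd (?h ((i + j) mod 3))" for i j
    by (rule h) simp
  show ?thesis
    unfolding orientation_def
  proof (rule ballI)
    fix d
    assume d: "d \<in> ends (pretzel p q r)"
    obtain i k c where d_eq: "d = ((i, k), c)"
      by (metis surj_pair)
    have ik: "i < 3" "k < ?h i"
      using d by (auto simp: d_eq ends_def pretzel_def)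
    then have k: "even k" if "Suc k = ?h i"
      using that h[of i] by (metis even_Suc)
    show "case d of (x, c) \<Rightarrow> ?o (arc (pretzel p q r) (x, c)) \<noteq> ?o (x, c) \<and> ?o (x, opposite c) \<noteq> ?o (x, c)"
      using k h'[of i 1] h'[of i 2] by (cases c) (auto simp: d_eq pretzel_def)
  qed
qed

end

theory Submission
  imports Defs
begin

text \<open>
  A set of ends is a union of closed curves iff it is preserved by following arcs and by passing
  through the crossings. Hence the result of the smoothings is a single curve iff every invariant
  two-colouring of the ends is constant (\<open>components_eq_1_iff\<close>). This trades reachability for
  propositional logic: a single curve is detected by equations between truth values, and a second
  curve is exhibited by one explicit colouring.

  With \<open>p\<close>, \<open>q\<close>, \<open>r\<close> odd, the unsmoothed diagram is a knot whose two strands in each column are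
  antiparallel. So at every crossing the oriented smoothing is the horizontal one, which turns the
  strands back, and the unoriented smoothing is the vertical one, which just removes a crossing of
  the column. Up to curves that are closed inside a column, a column therefore acts as one of three
  pieces: capped (with a horizontal smoothing), crossed (without one, an odd number of crossings
  being left) or straight (without one, an even number being left).

  Two horizontal smoothings in a column enclose a curve of their own. When each column has at most
  one, joining three such pieces gives one curve in the cases of three crossed columns, of two crossed
  columns and a straight one, of a capped, a straight and a crossed column, and of two capped columns
  with a third one of either other type; it gives two curves when three columns are capped, or when one
  is capped and the others are crossed. This is \<open>components_pretzel_eq_1_iff\<close>: the oriented
  crossings \<open>S\<close> lie in distinct columns and, beyond the knot itself, either there are two of them, or
  there is an unoriented crossing and its column contains no member of \<open>S\<close>.

  Counting is then elementary. For \<open>N0\<close> one chooses two crossings in distinct columns. For \<open>N1\<close> with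
  \<open>m = 2\<close> one chooses an ordered such pair, and with \<open>m = 3\<close> one adds to an unordered such pair an
  arbitrary third crossing, which gives \<open>(PQ + QR + PR) (P + Q + R - 2)\<close>.
\<close>
section \<open>Curves and invariant colourings\<close>

definition curve_colouring ::
  "'x diagram \<Rightarrow> ('x \<times> corner \<Rightarrow> bool) \<Rightarrow> ('x \<rightharpoonup> smoothing) \<Rightarrow> ('x \<times> corner \<Rightarrow> bool) \<Rightarrow> bool" where
  "curve_colouring D ori s K \<longleftrightarrow>
     (\<forall>d\<in>ends D. K (arc D d) = K d \<and> K (reconnect ori s d) = K d)"

lemma smoothing_involutions [simp]:
  "opposite (opposite c) = c" "vertical (vertical c) = c" "horizontal (horizontal c) = c"
  by (cases c; simp)+

lemma reconnect_reconnect: "reconnect ori s (reconnect ori s d) = d"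
proof -
  have smooth: "smooth ori x t (smooth ori x t c) = c" for x t c
    by (cases t) auto
  show ?thesis
    by (cases d) (auto simp: reconnect_def smooth split: option.split)
qed

lemma reconnect_in_ends: "d \<in> ends D \<Longrightarrow> reconnect ori s d \<in> ends D"
  by (auto simp: reconnect_def ends_def)

lemma step_sym:
  assumes "link_diagram D" and "(d, e) \<in> step D ori s"
  shows "(e, d) \<in> step D ori s"
proof -
  have "arc D d \<in> ends D \<and> arc D (arc D d) = d"
    using assms by (auto simp: link_diagram_def step_def)
  with assms show ?thesis
    unfolding step_def by (auto simp: reconnect_reconnect reconnect_in_ends)
qed

text \<open>
  Colours propagate along steps. Conversely, steps are reversible, so membership in the curve
  through a fixed end is itself an invariant colouring.
\<close>
lemma components_eq_1_iff:
  assumes D: "link_diagram D" and ne: "ends D \<noteq> {}"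
  shows "components D ori s = 1 \<longleftrightarrow>
    (\<forall>K. curve_colouring D ori s K \<longrightarrow> (\<forall>d\<in>ends D. \<forall>e\<in>ends D. K d = K e))"
    (is "_ \<longleftrightarrow> ?const")
proof -
  let ?r = "(step D ori s)\<^sup>*"
  have arc: "arc D d \<in> ends D \<and> arc D (arc D d) = d" if "d \<in> ends D" for d
    using D that by (auto simp: link_diagram_def)
  have in_ends: "e \<in> ends D" if "(d, e) \<in> ?r" "d \<in> ends D" for d e
    using that by (induction rule: rtrancl_induct) (auto simp: step_def arc reconnect_in_ends)
  have class_eq: "?r `` {d} = ends D" if all: "\<forall>e\<in>ends D. (d, e) \<in> ?r" and "d \<in> ends D" for d
    using that in_ends by blast
  have "components D ori s = 1 \<longleftrightarrow> (\<forall>d\<in>ends D. \<forall>e\<in>ends D. (d, e) \<in> ?r)"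
  proof
    assume "components D ori s = 1"
    then obtain X where X: "ends D // ?r = {X}"
      by (auto simp: components_def card_1_singleton_iff)
    have "?r `` {d} = X" if "d \<in> ends D" for d
      using X that by (metis quotientI singletonD)
    then show "\<forall>d\<in>ends D. \<forall>e\<in>ends D. (d, e) \<in> ?r"
      by blast
  next
    assume "\<forall>d\<in>ends D. \<forall>e\<in>ends D. (d, e) \<in> ?r"
    then have "ends D // ?r = {ends D}"
      using ne class_eq by (auto simp: quotient_def)
    then show "components D ori s = 1"
      by (simp add: components_def)
  qed
  also have "\<dots> \<longleftrightarrow> ?const"
  proof (rule iffI; intro allI impI ballI)
    fix K d e
    assume conn: "\<forall>d\<in>ends D. \<forall>e\<in>ends D. (d, e) \<in> ?r" and K: "curve_colouring D ori s K"
      and d: "d \<in> ends D" and e: "e \<in> ends D"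
    from conn d e have "(d, e) \<in> ?r"
      by blast
    then show "K d = K e"
    proof (induction rule: rtrancl_induct)
      case base
      show ?case ..
    next
      case (step e f)
      then have "K e = K f"
        using K unfolding step_def curve_colouring_def by blast
      with step.IH show ?case
        by simp
    qed
  next
    fix d e
    assume const: ?const and d: "d \<in> ends D" and e: "e \<in> ends D"
    have "curve_colouring D ori s (\<lambda>e. (d, e) \<in> ?r)"
      unfolding curve_colouring_def
    proof
      fix f
      assume f: "f \<in> ends D"
      have "(d, g) \<in> ?r \<longleftrightarrow> (d, f) \<in> ?r" if "(f, g) \<in> step D ori s" for g
        using that step_sym[OF D that] by (meson rtrancl.rtrancl_into_rtrancl)
      moreover have "(f, arc D f) \<in> step D ori s" "(f, reconnect ori s f) \<in> step D ori s"
        using f by (auto simp: step_def)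
      ultimately show "((d, arc D f) \<in> ?r) = ((d, f) \<in> ?r) \<and>
          ((d, reconnect ori s f) \<in> ?r) = ((d, f) \<in> ?r)"
        by blast
    qed
    with const d e show "(d, e) \<in> ?r"
      by blast
  qed
  finally show ?thesis .
qed

section \<open>Twist columns as boundary conditions on colours\<close>

text \<open>
  The way through a crossing when the strands of every column are antiparallel, so that the oriented
  smoothing is horizontal. In this form no orientation appears.
\<close>
fun turn :: "smoothing option \<Rightarrow> corner \<Rightarrow> corner" where
  "turn None = opposite"
| "turn (Some Oriented) = horizontal"
| "turn (Some Unoriented) = vertical"

definition column_colouring ::
  "(nat \<Rightarrow> nat) \<Rightarrow> (nat \<times> nat \<rightharpoonup> smoothing) \<Rightarrow> ((nat \<times> nat) \<times> corner \<Rightarrow> bool) \<Rightarrow> bool" where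
  "column_colouring h s K \<longleftrightarrow> (\<forall>i<3. \<forall>k<h i. \<forall>c.
     K (pretzel_arc h ((i, k), c)) = K ((i, k), c) \<and> K ((i, k), turn (s (i, k)) c) = K ((i, k), c))"

lemma column_colouring_arc:
  assumes "column_colouring h s K" and "i < 3" and "k < h i"
  shows "K (pretzel_arc h ((i, k), c)) = K ((i, k), c)"
  using assms by (simp add: column_colouring_def)

lemma column_colouring_turn:
  assumes "column_colouring h s K" and "i < 3" and "k < h i"
  shows "K ((i, k), turn (s (i, k)) c) = K ((i, k), c)"
  using assms by (simp add: column_colouring_def)

lemma column_colouring_down:
  assumes K: "column_colouring h s K" and "i < 3" and "Suc k < h i"
  shows "K ((i, Suc k), NW) = K ((i, k), SW)" and "K ((i, Suc k), NE) = K ((i, k), SE)"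
  using column_colouring_arc[OF K, of i k SW] column_colouring_arc[OF K, of i k SE] assms by auto

lemma column_colouring_through:
  assumes K: "column_colouring h s K" and i: "i < 3" "k < h i" and s: "s (i, k) \<noteq> Some Oriented"
  shows "(if s (i, k) = None
     then K ((i, k), SW) = K ((i, k), NE) \<and> K ((i, k), SE) = K ((i, k), NW)
     else K ((i, k), SW) = K ((i, k), NW) \<and> K ((i, k), SE) = K ((i, k), NE))"
proof -
  have "s (i, k) = None \<or> s (i, k) = Some Unoriented"
    using s by (metis not_None_eq smoothing.exhaust)
  then show ?thesis
    using column_colouring_turn[OF K i, of NW] column_colouring_turn[OF K i, of NE] by auto
qed

text \<open>
  A cap forces equal colours on its two ends. Through a crossing or a vertical smoothing this
  equality passes to the next pair of ends, upwards from the cap to the top of the column and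
  downwards from the cup to its bottom.
\<close>
lemma capped_column:
  assumes K: "column_colouring h s K" and i: "i < 3" and k: "k < h i"
    and cap: "s (i, k) = Some Oriented"
    and only: "\<And>l. l < h i \<Longrightarrow> s (i, l) = Some Oriented \<Longrightarrow> l = k"
  shows "K ((i, 0), NW) = K ((i, 0), NE)"
    and "K ((i, h i - 1), SW) = K ((i, h i - 1), SE)"
    and "l < h i \<Longrightarrow> K ((i, l), c) = K ((i, 0), NW) \<or> K ((i, l), c) = K ((i, h i - 1), SW)"
proof -
  have cup: "K ((i, k), NW) = K ((i, k), NE)" "K ((i, k), SW) = K ((i, k), SE)"
    using column_colouring_turn[OF K i k, of NW] column_colouring_turn[OF K i k, of SW] cap by auto
  have through: "(if s (i, l) = None
     then K ((i, l), SW) = K ((i, l), NE) \<and> K ((i, l), SE) = K ((i, l), NW)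
     else K ((i, l), SW) = K ((i, l), NW) \<and> K ((i, l), SE) = K ((i, l), NE))"
    if "l < h i" "l \<noteq> k" for l
    using column_colouring_through[OF K i] only that by blast
  have upper: "K ((i, l), NW) = K ((i, k), NW) \<and> K ((i, l), NE) = K ((i, k), NW)" if "l \<le> k" for l
    using that
  proof (induction rule: inc_induct)
    case base
    then show ?case using cup by simp
  next
    case (step l)
    then show ?case
      using column_colouring_down[OF K i, of l] through[of l] k by (auto split: if_splits)
  qed
  have lower: "K ((i, l), SW) = K ((i, k), SW) \<and> K ((i, l), SE) = K ((i, k), SW)"
    if "k \<le> l" "l < h i" for l
    using that
  proof (induction rule: dec_induct)
    case base
    then show ?case using cup by simp
  next
    case (step l)
    then show ?case
      using column_colouring_down[OF K i, of l] through[of "Suc l"] by (auto split: if_splits)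
  qed
  show "K ((i, 0), NW) = K ((i, 0), NE)"
    using upper[of 0] by simp
  have "k \<le> h i - 1" "h i - 1 < h i"
    using k by auto
  note last = lower[OF this]
  then show "K ((i, h i - 1), SW) = K ((i, h i - 1), SE)"
    by simp
  show "K ((i, l), c) = K ((i, 0), NW) \<or> K ((i, l), c) = K ((i, h i - 1), SW)" if l: "l < h i"
  proof (cases l k rule: linorder_cases)
    case less
    then show ?thesis
      using upper[of 0] upper[of l] through[OF l] by (cases c) (auto split: if_splits)
  next
    case equal
    then show ?thesis
      using upper[of 0] last cup by (cases c) auto
  next
    case greater
    then show ?thesis
      using last lower[of l] through[OF l] l by (cases c) (auto split: if_splits)
  qed
qed

text \<open>
  Going down a column without caps, the two strands change sides exactly at the unsmoothed crossings.
\<close>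
lemma uncapped_column:
  assumes K: "column_colouring h s K" and i: "i < 3" and l: "l < h i"
    and no_cap: "\<And>l. l < h i \<Longrightarrow> s (i, l) \<noteq> Some Oriented"
  shows "K ((i, l), SW) = K ((i, 0), if odd (card {k. k \<le> l \<and> s (i, k) = None}) then NE else NW)"
    and "K ((i, l), SE) = K ((i, 0), if odd (card {k. k \<le> l \<and> s (i, k) = None}) then NW else NE)"
    and "K ((i, l), c) = K ((i, 0), NW) \<or> K ((i, l), c) = K ((i, 0), NE)"
proof -
  let ?x = "\<lambda>l. card {k. k \<le> l \<and> s (i, k) = None}"
  note through = column_colouring_through[OF K i _ no_cap]
  have x_0: "?x 0 = (if s (i, 0) = None then 1 else 0)"
  proof -
    have "{k. k \<le> 0 \<and> s (i, k) = None} = (if s (i, 0) = None then {0} else {})"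
      by auto
    then show ?thesis by simp
  qed
  have x_Suc: "?x (Suc l) = (if s (i, Suc l) = None then Suc (?x l) else ?x l)" for l
  proof -
    have "{k. k \<le> Suc l \<and> s (i, k) = None} =
      (if s (i, Suc l) = None then insert (Suc l) else id) {k. k \<le> l \<and> s (i, k) = None}"
      by (auto simp: le_Suc_eq)
    then show ?thesis by simp
  qed
  have both: "K ((i, l), SW) = K ((i, 0), if odd (?x l) then NE else NW) \<and>
      K ((i, l), SE) = K ((i, 0), if odd (?x l) then NW else NE)" if "l < h i" for l
    using that
  proof (induction l)
    case 0
    then show ?case
      using through[of 0] unfolding x_0 by (auto split: if_splits)
  next
    case (Suc l)
    then show ?case
      using through[of "Suc l"] column_colouring_down[OF K i, of l] unfolding x_Suc
      by (auto split: if_splits)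
  qed
  show "K ((i, l), SW) = K ((i, 0), if odd (?x l) then NE else NW)"
    and "K ((i, l), SE) = K ((i, 0), if odd (?x l) then NW else NE)"
    using both[OF l] by auto
  show "K ((i, l), c) = K ((i, 0), NW) \<or> K ((i, l), c) = K ((i, 0), NE)"
    using both[OF l] through[OF l] l by (cases c) (auto split: if_splits)
qed

text \<open>
  The propositional core of the positive cases. \<open>T i\<close> and \<open>B i\<close> are the colours at the top and the
  bottom of column \<open>i\<close>, \<open>H\<close> is the set of capped columns, and \<open>V\<close> is the set of columns containing
  the unoriented smoothing.
\<close>
lemma closed_frame:
  fixes T B :: "nat \<Rightarrow> corner \<Rightarrow> bool"
  assumes top: "T 0 NE = T 1 NW" "T 1 NE = T 2 NW" "T 2 NE = T 0 NW"
    and bottom: "B 0 SE = B 1 SW" "B 1 SE = B 2 SW" "B 2 SE = B 0 SW"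
    and capped: "\<And>i. i < 3 \<Longrightarrow> i \<in> H \<Longrightarrow> T i NW = T i NE \<and> B i SW = B i SE"
    and straight: "\<And>i. i < 3 \<Longrightarrow> i \<notin> H \<Longrightarrow> i \<in> V \<Longrightarrow> T i NW = B i SW \<and> T i NE = B i SE"
    and crossed: "\<And>i. i < 3 \<Longrightarrow> i \<notin> H \<Longrightarrow> i \<notin> V \<Longrightarrow> T i NW = B i SE \<and> T i NE = B i SW"
    and H: "H \<subseteq> {0, 1, 2}"
    and closed: "V = {} \<and> (H = {} \<or> card H = 2) \<or> (\<exists>j<3. V = {j} \<and> (card H = 2 \<or> j \<notin> H))"
    and i: "i < 3"
  shows "T i NW = T 0 NW \<and> T i NE = T 0 NW \<and> B i SW = T 0 NW \<and> B i SE = T 0 NW"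
proof -
  have less_3: "(\<exists>j<3. P j) \<longleftrightarrow> P 0 \<or> P 1 \<or> P (2::nat)" for P
    by (auto simp: numeral_3_eq_3 numeral_2_eq_2 less_Suc_eq)
  have card_2: "card H = 2 \<longleftrightarrow> 0 \<in> H \<and> 1 \<in> H \<and> 2 \<notin> H \<or>
      0 \<in> H \<and> 1 \<notin> H \<and> 2 \<in> H \<or> 0 \<notin> H \<and> 1 \<in> H \<and> 2 \<in> H"
  proof -
    have "H \<in> {{}, {0}, {1}, {2}, {0, 1}, {0, 2}, {1, 2}, {0, 1, 2}}"
      using H by (auto simp flip: Pow_iff simp: Pow_insert)
    then show ?thesis
      by (elim insertE emptyE) simp_all
  qed
  have empty: "H = {} \<longleftrightarrow> 0 \<notin> H \<and> 1 \<notin> H \<and> 2 \<notin> H"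
    using H by auto
  have closed: "0 \<notin> V \<and> 1 \<notin> V \<and> 2 \<notin> V \<and> (H = {} \<or> card H = 2) \<or>
      0 \<in> V \<and> 1 \<notin> V \<and> 2 \<notin> V \<and> (card H = 2 \<or> 0 \<notin> H) \<or>
      0 \<notin> V \<and> 1 \<in> V \<and> 2 \<notin> V \<and> (card H = 2 \<or> 1 \<notin> H) \<or>
      0 \<notin> V \<and> 1 \<notin> V \<and> 2 \<in> V \<and> (card H = 2 \<or> 2 \<notin> H)"
    using closed unfolding less_3 by auto
  have column: "(i \<in> H \<longrightarrow> T i NW = T i NE \<and> B i SW = B i SE) \<and>
      (i \<notin> H \<longrightarrow> i \<in> V \<longrightarrow> T i NW = B i SW \<and> T i NE = B i SE) \<and>
      (i \<notin> H \<longrightarrow> i \<notin> V \<longrightarrow> T i NW = B i SE \<and> T i NE = B i SW)" if "i < 3" for i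
    using that capped straight crossed by blast
  have columns: "0 < (3::nat)" "1 < (3::nat)" "2 < (3::nat)"
    by auto
  note facts = columns[THEN column] top bottom closed[unfolded card_2 empty]
  have "T 0 NE = T 0 NW" "B 0 SW = T 0 NW" "B 0 SE = T 0 NW"
      "T 1 NW = T 0 NW" "T 1 NE = T 0 NW" "B 1 SW = T 0 NW" "B 1 SE = T 0 NW"
      "T 2 NW = T 0 NW" "T 2 NE = T 0 NW" "B 2 SW = T 0 NW" "B 2 SE = T 0 NW"
    by (insert facts; argo)+
  moreover have "i = 0 \<or> i = 1 \<or> i = 2"
    using i by auto
  ultimately show ?thesis
    by auto
qed

section \<open>Which smoothings leave a single curve\<close>

definition smoothed :: "('x \<rightharpoonup> smoothing) \<Rightarrow> smoothing \<Rightarrow> 'x set" where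
  "smoothed s t = {x. s x = Some t}"

definition pretzel_crossings :: "(nat \<Rightarrow> nat) \<Rightarrow> (nat \<times> nat) set" where
  "pretzel_crossings h = {(i, k). i < 3 \<and> k < h i}"

text \<open>
  The positions \<open>S\<close> of the oriented smoothings and \<open>U\<close> of at most one unoriented smoothing that leave
  a single curve.
\<close>
definition single_curve_pattern :: "(nat \<times> nat) set \<Rightarrow> (nat \<times> nat) set \<Rightarrow> bool" where
  "single_curve_pattern S U \<longleftrightarrow> inj_on fst S \<and>
     (U = {} \<and> (S = {} \<or> card S = 2) \<or> (\<exists>x. U = {x} \<and> (card S = 2 \<or> fst x \<notin> fst ` S)))"

lemma dom_smoothed: "dom s = smoothed s Oriented \<union> smoothed s Unoriented"
proof -
  have "s x \<noteq> None \<longleftrightarrow> s x = Some Oriented \<or> s x = Some Unoriented" for x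
    by (metis option.distinct(1) option.exhaust smoothing.exhaust)
  then show ?thesis
    by (auto simp: smoothed_def dom_def)
qed

text \<open>
  Removing one crossing of a column makes the number of remaining crossings even. Thus uncapped
  columns are crossed or straight according to whether they contain the unoriented smoothing.
\<close>
lemma colouring_constant:
  assumes odd_h: "\<And>i. i < 3 \<Longrightarrow> odd (h i)"
    and dom: "dom s \<subseteq> pretzel_crossings h"
    and K: "column_colouring h s K"
    and pattern: "single_curve_pattern (smoothed s Oriented) (smoothed s Unoriented)"
    and x: "x \<in> pretzel_crossings h"
  shows "K (x, c) = K ((0, 0), NW)"
proof -
  define S where "S = smoothed s Oriented"
  define U where "U = smoothed s Unoriented"
  have sub: "S \<subseteq> pretzel_crossings h" "U \<subseteq> pretzel_crossings h"
    using dom unfolding dom_smoothed S_def U_def by auto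
  have inj: "inj_on fst S"
    and pat: "U = {} \<and> (S = {} \<or> card S = 2) \<or> (\<exists>x. U = {x} \<and> (card S = 2 \<or> fst x \<notin> fst ` S))"
    using pattern by (auto simp: single_curve_pattern_def S_def U_def)
  have pos: "0 < h i" if "i < 3" for i
    using odd_h[OF that] by (rule odd_pos)
  define T where "T = (\<lambda>i c. K ((i, 0::nat), c))"
  define B where "B = (\<lambda>i c. K ((i, h i - 1), c))"
  have capped: "T i NW = T i NE \<and> B i SW = B i SE \<and>
      (\<forall>l<h i. \<forall>c. K ((i, l), c) = T i NW \<or> K ((i, l), c) = B i SW)"
    if i: "i < 3" and iS: "i \<in> fst ` S" for i
  proof -
    obtain k where k: "(i, k) \<in> S"
      using iS by auto
    have "l = k" if "s (i, l) = Some Oriented" for l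
      using inj_onD[OF inj, of "(i, l)" "(i, k)"] that k by (auto simp: S_def smoothed_def)
    moreover have "k < h i" "s (i, k) = Some Oriented"
      using k sub by (auto simp: pretzel_crossings_def S_def smoothed_def)
    ultimately show ?thesis
      using capped_column[OF K i] unfolding T_def B_def by blast
  qed
  have uncapped: "(if odd (card {k. k < h i \<and> s (i, k) = None})
        then T i NW = B i SE \<and> T i NE = B i SW else T i NW = B i SW \<and> T i NE = B i SE) \<and>
      (\<forall>l<h i. \<forall>c. K ((i, l), c) = T i NW \<or> K ((i, l), c) = T i NE)"
    if i: "i < 3" and iS: "i \<notin> fst ` S" for i
  proof -
    have no_cap: "s (i, l) \<noteq> Some Oriented" for l
      using iS by (force simp: S_def smoothed_def)
    have "{k. k \<le> h i - 1 \<and> s (i, k) = None} = {k. k < h i \<and> s (i, k) = None}"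
      using pos[OF i] by auto
    moreover have "h i - 1 < h i"
      using pos[OF i] by auto
    ultimately show ?thesis
      using uncapped_column[OF K i _ no_cap] unfolding T_def B_def by (auto split: if_splits)
  qed
  have crossed: "odd (card {k. k < h i \<and> s (i, k) = None})"
    if i: "i < 3" and iS: "i \<notin> fst ` S" and iU: "i \<notin> fst ` U" for i
  proof -
    have "(i, k) \<notin> dom s" for k
      using iS iU unfolding dom_smoothed S_def U_def by force
    then have "{k. k < h i \<and> s (i, k) = None} = {..<h i}"
      by auto
    then show ?thesis
      using odd_h[OF i] by simp
  qed
  \<comment> \<open>The vertical smoothing at \<open>u\<close> is the only smoothing in its column.\<close>
  have straight: "even (card {k. k < h i \<and> s (i, k) = None})"
    if i: "i < 3" and iS: "i \<notin> fst ` S" and iU: "i \<in> fst ` U" for i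
  proof -
    obtain u where u: "(i, u) \<in> U"
      using iU by auto
    then have U: "U = {(i, u)}"
      using pat by auto
    have "(i, k) \<in> dom s \<longleftrightarrow> k = u" for k
      using iS U unfolding dom_smoothed S_def U_def by force
    then have "{k. k < h i \<and> s (i, k) = None} = {..<h i} - {u}"
      by auto
    moreover have "u < h i"
      using u sub by (auto simp: pretzel_crossings_def)
    ultimately show ?thesis
      using odd_h[OF i] by simp
  qed
  have adjacent: "T i NE = T ((i + 1) mod 3) NW \<and> B i SE = B ((i + 1) mod 3) SW" if i: "i < 3" for i
    using column_colouring_arc[OF K i pos[OF i], of NE] column_colouring_arc[OF K i, of "h i - 1" SE]
      pos[OF i] by (simp add: T_def B_def)
  have top: "T 0 NE = T 1 NW" "T 1 NE = T 2 NW" "T 2 NE = T 0 NW"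
    and bottom: "B 0 SE = B 1 SW" "B 1 SE = B 2 SW" "B 2 SE = B 0 SW"
    using adjacent[of 0] adjacent[of 1] adjacent[of 2] by (simp_all add: numeral_2_eq_2)
  have H: "fst ` S \<subseteq> {0, 1, 2}"
    using sub(1) by (force simp: pretzel_crossings_def)
  have closed: "fst ` U = {} \<and> (fst ` S = {} \<or> card (fst ` S) = 2) \<or>
      (\<exists>j<3. fst ` U = {j} \<and> (card (fst ` S) = 2 \<or> j \<notin> fst ` S))"
    using pat
  proof (elim disjE exE conjE)
    fix x
    assume "U = {x}" "fst x \<notin> fst ` S"
    then show ?thesis
      using sub(2) by (auto simp: pretzel_crossings_def)
  next
    fix x
    assume "U = {x}" "card S = 2"
    then show ?thesis
      using sub(2) by (auto simp: pretzel_crossings_def card_image[OF inj])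
  qed (simp_all add: card_image[OF inj])
  have frame: "T i NW = T 0 NW \<and> T i NE = T 0 NW \<and> B i SW = T 0 NW \<and> B i SE = T 0 NW"
    if "i < 3" for i
  proof (rule closed_frame[OF top bottom _ _ _ H closed that])
    fix i :: nat
    assume i: "i < 3"
    show "i \<in> fst ` S \<Longrightarrow> T i NW = T i NE \<and> B i SW = B i SE"
      using capped[OF i] by blast
    show "T i NW = B i SW \<and> T i NE = B i SE" if "i \<notin> fst ` S" "i \<in> fst ` U"
      using uncapped[OF i that(1)] straight[OF i that] by simp
    show "T i NW = B i SE \<and> T i NE = B i SW" if "i \<notin> fst ` S" "i \<notin> fst ` U"
      using uncapped[OF i that(1)] crossed[OF i that] by simp
  qed
  obtain i l where il: "x = (i, l)" "i < 3" "l < h i"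
    using x by (auto simp: pretzel_crossings_def)
  have "K ((i, l), c) = T 0 NW"
    using capped[OF il(2)] uncapped[OF il(2)] frame[OF il(2)] il(3) by blast
  then show ?thesis
    by (simp add: il T_def)
qed

text \<open>
  The negative cases come from three colourings that single out a union of curves. The first one
  consists of everything enclosed between two horizontal smoothings of the same column.
\<close>
lemma colouring_between_caps:
  assumes "s (i, k) = Some Oriented" "s (i, k') = Some Oriented" "k < k'" "k' < h i"
  shows "column_colouring h s (\<lambda>((j, l), c). j = i \<and>
    (k < l \<and> l < k' \<or> l = k \<and> c \<in> {SW, SE} \<or> l = k' \<and> c \<in> {NW, NE}))"
    (is "column_colouring h s ?K")
  unfolding column_colouring_def
proof (intro allI impI conjI)
  fix j l c
  assume "j < 3" "l < h j"
  then show "?K (pretzel_arc h ((j, l), c)) = ?K ((j, l), c)"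
    using assms by (cases c) auto
  show "?K ((j, l), turn (s (j, l)) c) = ?K ((j, l), c)"
    using assms by (cases c) auto
qed

text \<open>When every column is cut horizontally, the part above the cuts separates.\<close>
lemma colouring_above_caps:
  assumes "\<And>i. i < 3 \<Longrightarrow> k i < h i \<and> s (i, k i) = Some Oriented"
  shows "column_colouring h s (\<lambda>((i, l), c). l < k i \<or> l = k i \<and> c \<in> {NW, NE})"
    (is "column_colouring h s ?K")
  unfolding column_colouring_def
proof (intro allI impI conjI)
  fix i l c
  assume i: "i < 3" "l < h i"
  have "k i < h i" "k ((i + 1) mod 3) < h ((i + 1) mod 3)" "k ((i + 2) mod 3) < h ((i + 2) mod 3)"
    using i assms by auto
  then show "?K (pretzel_arc h ((i, l), c)) = ?K ((i, l), c)"
    using i by (cases c) auto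
  show "?K ((i, l), turn (s (i, l)) c) = ?K ((i, l), c)"
    using assms[OF i(1)] by (cases c) auto
qed

text \<open>
  With one capped column and two unsmoothed ones, the two curves run through the unsmoothed columns
  along complementary strands. The curve coloured here closes up through the cap at the top of
  column \<open>a\<close>. It starts at the top left of column \<open>a + 1\<close> and at the top right of column \<open>a + 2\<close>; as the
  heights are odd, it ends at the bottom right of the former and at the bottom left of the latter,
  where these columns meet.
\<close>
lemma colouring_one_capped_column:
  assumes odd_h: "\<And>i. i < 3 \<Longrightarrow> odd (h i)"
    and a: "a < 3" "k < h a" "s (a, k) = Some Oriented"
    and unsmoothed: "\<And>i l. i \<noteq> a \<Longrightarrow> s (i, l) = None"
  shows "column_colouring h s (\<lambda>((i, l), c).
    if i = a then l < k \<or> l = k \<and> c \<in> {NW, NE}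
    else if i = (a + 1) mod 3 then even l \<longleftrightarrow> c \<in> {NW, SE}
    else even l \<longleftrightarrow> c \<in> {NE, SW})"
    (is "column_colouring h s ?K")
  unfolding column_colouring_def
proof (intro allI impI conjI)
  fix i l c
  assume i: "i < 3" "l < h i"
  have odds: "odd (h 0)" "odd (h (Suc 0))" "odd (h 2)"
    using odd_h by auto
  then have pos: "h 0 > 0" "h (Suc 0) > 0" "h 2 > 0"
    by (auto intro: odd_pos)
  have last: "even l" if "Suc l = h i"
    using that odd_h[OF i(1)] by (metis even_Suc)
  have cases: "i = 0 \<or> i = Suc 0 \<or> i = 2" "a = 0 \<or> a = Suc 0 \<or> a = 2"
    using i a by auto
  show "?K (pretzel_arc h ((i, l), c)) = ?K ((i, l), c)"
    using cases odds pos last i a(2)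
    by (cases c; elim disjE; simp split: if_splits; auto simp: numeral_2_eq_2)
  show "?K ((i, l), turn (s (i, l)) c) = ?K ((i, l), c)"
    using a(3) unsmoothed[of i l] by (cases c) auto
qed

text \<open>
  If the pattern fails, then two oriented smoothings share a column, or all columns are capped, or
  all smoothings, at least one of them oriented, lie in a single column. Each of these situations
  has its separating colouring.
\<close>
lemma constant_iff_pattern:
  assumes odd_h: "\<And>i. i < 3 \<Longrightarrow> odd (h i)"
    and dom: "dom s \<subseteq> pretzel_crossings h"
    and U: "smoothed s Unoriented = {} \<or> (\<exists>x. smoothed s Unoriented = {x})"
  shows "(\<forall>K. column_colouring h s K \<longrightarrow>
      (\<forall>d\<in>pretzel_crossings h \<times> UNIV. \<forall>e\<in>pretzel_crossings h \<times> UNIV. K d = K e)) \<longleftrightarrow>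
    single_curve_pattern (smoothed s Oriented) (smoothed s Unoriented)"
    (is "?const \<longleftrightarrow> ?pattern")
proof
  assume ?pattern
  then show ?const
    using colouring_constant[OF odd_h dom] by (metis SigmaE)
next
  assume const: ?const
  define S where "S = smoothed s Oriented"
  define U where "U = smoothed s Unoriented"
  have S: "x \<in> S \<longleftrightarrow> s x = Some Oriented" for x
    by (simp add: S_def smoothed_def)
  have sub: "S \<subseteq> pretzel_crossings h" "U \<subseteq> pretzel_crossings h"
    using dom unfolding dom_smoothed S_def U_def by auto
  have constD: "K ((i, k), c) = K ((j, l), e)"
    if "column_colouring h s K" "i < 3" "k < h i" "j < 3" "l < h j" for K i j k l c e
  proof -
    have "((i, k), c) \<in> pretzel_crossings h \<times> UNIV" "((j, l), e) \<in> pretzel_crossings h \<times> UNIV"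
      using that by (auto simp: pretzel_crossings_def)
    then show ?thesis
      using const that(1) by blast
  qed
  have S_less: "i < 3" "k < h i" if "(i, k) \<in> S" for i k
    using that sub by (auto simp: pretzel_crossings_def)
  \<comment> \<open>The contradictions below arise from the colours just above and just below a cap.\<close>
  have no_two: False if "(i, k) \<in> S" "(i, k') \<in> S" "k < k'" for i k k'
    using constD[OF colouring_between_caps[of s i k k' h], of i k i k NW SW] that S_less S by auto
  have inj: "inj_on fst S"
  proof (rule inj_onI)
    fix x y
    assume "x \<in> S" "y \<in> S" "fst x = fst y"
    then show "x = y"
      using no_two[of "fst x" "snd x" "snd y"] no_two[of "fst x" "snd y" "snd x"]
      by (cases x; cases y) (auto intro: linorder_cases)
  qed
  have not_all: "\<exists>i<3. i \<notin> fst ` S"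
  proof (rule ccontr)
    assume "\<not> ?thesis"
    then have "\<forall>i. \<exists>k. i < 3 \<longrightarrow> (i, k) \<in> S"
      by force
    then obtain k where k: "\<And>i. i < 3 \<Longrightarrow> (i, k i) \<in> S"
      by metis
    then have "k i < h i \<and> s (i, k i) = Some Oriented" if "i < 3" for i
      using that S S_less by blast
    from constD[OF colouring_above_caps[of k h s, OF this], of 0 "k 0" 0 "k 0" NW SW] k[of 0] S_less
    show False by auto
  qed
  have elsewhere: "\<exists>x\<in>S \<union> U. fst x \<noteq> i" if iS: "i \<in> fst ` S" for i
  proof (rule ccontr)
    assume none: "\<not> ?thesis"
    obtain k where k: "(i, k) \<in> S"
      using iS by auto
    have "s (j, l) = None" if "j \<noteq> i" for j l
      using none that dom_smoothed[of s] unfolding S_def U_def by (metis UnCI domIff fst_conv)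
    note K = colouring_one_capped_column[of h i k s, OF odd_h S_less[OF k] _ this]
    show False
      using constD[OF K, of i k i k NW SW] k S S_less[OF k] by auto
  qed
  have card_2: "card S = 2" if ij: "i \<in> fst ` S" "j \<in> fst ` S" "i \<noteq> j" for i j
  proof -
    obtain k where k: "k < 3" "k \<notin> fst ` S"
      using not_all by blast
    have "fst ` S \<subseteq> {..<3} - {k}"
      using k S_less by force
    then have fin: "finite (fst ` S)" and "card (fst ` S) \<le> card ({..<3} - {k})"
      by (auto intro: finite_subset card_mono)
    then have "card (fst ` S) \<le> 2"
      using k by simp
    moreover have "card {i, j} \<le> card (fst ` S)"
      using ij fin by (intro card_mono) auto
    ultimately show ?thesis
      using ij by (simp add: card_image[OF inj])
  qed
  have card_2': "card S = 2" if i: "i \<in> fst ` S" and U: "\<And>x. x \<in> U \<Longrightarrow> fst x = i" for i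
  proof -
    obtain y where "y \<in> S" "fst y \<noteq> i"
      using elsewhere[OF i] U by blast
    then show ?thesis
      using card_2[OF i] by (metis imageI)
  qed
  have "U = {} \<and> (S = {} \<or> card S = 2) \<or> (\<exists>x. U = {x} \<and> (card S = 2 \<or> fst x \<notin> fst ` S))"
  proof (cases "U = {}")
    case True
    then have "card S = 2" if "x \<in> S" for x
      using card_2'[of "fst x"] that by simp
    with True show ?thesis
      by blast
  next
    case False
    then obtain x where x: "U = {x}"
      using U by (auto simp: U_def)
    then have "card S = 2" if "fst x \<in> fst ` S"
      using card_2'[OF that] by simp
    with x show ?thesis
      by blast
  qed
  with inj show ?pattern
    by (simp add: single_curve_pattern_def S_def U_def)
qed

section \<open>Pretzel diagrams with odd columns\<close>

lemma crossings_pretzel: "crossings (pretzel p q r) = pretzel_crossings (height p q r)"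
  by (simp add: pretzel_def pretzel_crossings_def)

lemma ends_pretzel: "ends (pretzel p q r) = pretzel_crossings (height p q r) \<times> UNIV"
  by (simp add: ends_def crossings_pretzel)

lemma arc_pretzel: "arc (pretzel p q r) = pretzel_arc (height p q r)"
  by (simp add: pretzel_def)

lemma odd_height:
  assumes "odd p" "odd q" "odd r" and "i < 3"
  shows "odd (height p q r i)"
proof -
  have "i = 0 \<or> i = Suc 0 \<or> i = 2"
    using assms(4) by linarith
  then show ?thesis
    using assms by (auto simp: height_def twist_def even_nat_iff)
qed

text \<open>
  Every orientation is the antiparallel one or its reverse: an orientation flips at each step, so
  the set of ends where two orientations agree is invariant in the unsmoothed diagram, and that
  diagram is a single curve.
\<close>
lemma orientation_antiparallel:
  assumes odd: "odd p" "odd q" "odd r"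
    and ori: "orientation (pretzel p q r) ori"
    and x: "x \<in> pretzel_crossings (height p q r)"
  shows "ori (x, vertical c) = ori (x, c)"
proof -
  let ?D = "pretzel p q r" and ?h = "height p q r"
  let ?ori = "\<lambda>((i, k), c). even k \<longleftrightarrow> c = NW \<or> c = SW"
  \<comment> \<open>\<open>K\<close> marks the ends where \<open>ori\<close> agrees with the standard orientation.\<close>
  define K where "K = (\<lambda>d. ori d \<longleftrightarrow> ?ori d)"
  have opp: "K (arc ?D (x, c)) = K (x, c) \<and> K (x, opposite c) = K (x, c)"
    if "x \<in> pretzel_crossings ?h" for x c
  proof -
    have flip: "f (arc ?D (x, c)) \<noteq> f (x, c) \<and> f (x, opposite c) \<noteq> f (x, c)"
      if "orientation ?D f" for f
      using that \<open>x \<in> _\<close> by (auto simp: orientation_def ends_pretzel)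
    show ?thesis
      using flip[OF ori] flip[OF orientation_pretzel_odd[OF odd]] unfolding K_def by argo
  qed
  have "column_colouring ?h Map.empty K"
    using opp by (simp add: column_colouring_def arc_pretzel pretzel_crossings_def)
  then have "K (x, vertical c) = K (x, c)"
    using colouring_constant[of ?h Map.empty K x c]
      colouring_constant[of ?h Map.empty K x "vertical c"] odd_height[OF odd] x
    by (simp add: single_curve_pattern_def smoothed_def)
  then show ?thesis
    by (cases x; cases c) (auto simp: K_def)
qed

lemma components_pretzel_eq_1_iff:
  assumes odd: "odd p" "odd q" "odd r"
    and ori: "orientation (pretzel p q r) ori"
    and dom: "dom s \<subseteq> pretzel_crossings (height p q r)"
    and U: "smoothed s Unoriented = {} \<or> (\<exists>x. smoothed s Unoriented = {x})"
  shows "components (pretzel p q r) ori s = 1 \<longleftrightarrow>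
    single_curve_pattern (smoothed s Oriented) (smoothed s Unoriented)"
proof -
  let ?D = "pretzel p q r" and ?h = "height p q r"
  have "\<not> coherent ori x vertical" if "x \<in> pretzel_crossings ?h" for x
    using orientation_antiparallel[OF odd ori that] by (auto simp: coherent_def)
  then have turn: "reconnect ori s (x, c) = (x, turn (s x) c)" if "x \<in> pretzel_crossings ?h" for x c
    using that by (cases "s x" rule: turn.cases) (auto simp: reconnect_def)
  have colouring: "curve_colouring ?D ori s K \<longleftrightarrow> column_colouring ?h s K" for K
    unfolding curve_colouring_def column_colouring_def ends_pretzel arc_pretzel
    using turn by (auto simp: pretzel_crossings_def)
  have "p \<noteq> 0" "q \<noteq> 0" "r \<noteq> 0"
    using odd by auto
  then have D: "link_diagram ?D"
    by (rule link_diagram_pretzel)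
  have "((0, 0), NW) \<in> ends ?D"
    using odd_height[OF odd, of 0] by (auto simp: ends_pretzel pretzel_crossings_def intro: odd_pos)
  then have "ends ?D \<noteq> {}"
    by blast
  note components_eq_1_iff[OF D this]
  also have "(\<forall>K. curve_colouring ?D ori s K \<longrightarrow> (\<forall>d\<in>ends ?D. \<forall>e\<in>ends ?D. K d = K e)) \<longleftrightarrow>
      single_curve_pattern (smoothed s Oriented) (smoothed s Unoriented)"
    unfolding colouring ends_pretzel by (rule constant_iff_pattern[OF odd_height[OF odd] dom U])
  finally show ?thesis .
qed

section \<open>Counting the choices that leave one curve\<close>

definition pairs_in_distinct_columns :: "(nat \<times> nat) set \<Rightarrow> (nat \<times> nat) set set" where
  "pairs_in_distinct_columns C = {S. S \<subseteq> C \<and> card S = 2 \<and> inj_on fst S}"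

lemma pretzel_crossings_Sigma: "pretzel_crossings h = (SIGMA i:{0, 1, 2}. {..<h i})"
proof -
  have "i < 3 \<longleftrightarrow> i \<in> {0, 1, 2}" for i :: nat
    by auto
  then show ?thesis
    unfolding pretzel_crossings_def by blast
qed

lemma finite_pretzel_crossings: "finite (pretzel_crossings h)"
  unfolding pretzel_crossings_Sigma by (intro finite_SigmaI) auto

lemma card_pretzel_crossings: "card (pretzel_crossings h) = h 0 + h 1 + h 2"
  unfolding pretzel_crossings_Sigma by (subst card_SigmaI) auto

text \<open>
  Ordering a pair by columns gives it a canonical first member, so that unordered pairs become
  elements of products of columns.
\<close>
lemma card_increasing_pairs:
  "card {(x, y). x \<in> pretzel_crossings h \<and> y \<in> pretzel_crossings h \<and> fst x < fst y} =
    h 0 * h 1 + h 1 * h 2 + h 0 * h 2"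
proof -
  define col where "col = (\<lambda>i. {i} \<times> {..<h i})"
  have col: "finite (col i)" "card (col i) = h i" for i
    by (simp_all add: col_def)
  have "{(x, y). x \<in> pretzel_crossings h \<and> y \<in> pretzel_crossings h \<and> fst x < fst y} =
      col 0 \<times> col 1 \<union> (col 1 \<times> col 2 \<union> col 0 \<times> col 2)"
    unfolding pretzel_crossings_Sigma col_def by auto
  moreover have "col 0 \<times> col 1 \<inter> (col 1 \<times> col 2 \<union> col 0 \<times> col 2) = {}"
    and "col 1 \<times> col 2 \<inter> col 0 \<times> col 2 = {}"
    by (auto simp: col_def)
  ultimately show ?thesis
    by (simp add: card_Un_disjoint card_cartesian_product col)
qed

lemma card_pairs_in_distinct_columns:
  "card (pairs_in_distinct_columns (pretzel_crossings h)) = h 0 * h 1 + h 1 * h 2 + h 0 * h 2"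
proof -
  let ?I = "{(x, y). x \<in> pretzel_crossings h \<and> y \<in> pretzel_crossings h \<and> fst x < fst y}"
  have "bij_betw (\<lambda>(x, y). {x, y}) ?I (pairs_in_distinct_columns (pretzel_crossings h))"
  proof (rule bij_betw_imageI)
    show "inj_on (\<lambda>(x, y). {x, y}) ?I"
      by (auto simp: inj_on_def doubleton_eq_iff)
    show "(\<lambda>(x, y). {x, y}) ` ?I = pairs_in_distinct_columns (pretzel_crossings h)"
    proof (intro equalityI subsetI)
      fix S
      assume "S \<in> (\<lambda>(x, y). {x, y}) ` ?I"
      then obtain z where "z \<in> ?I" "S = (case z of (x, y) \<Rightarrow> {x, y})"
        by blast
      then show "S \<in> pairs_in_distinct_columns (pretzel_crossings h)"
        by (cases z) (auto simp: pairs_in_distinct_columns_def card_insert_if)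
    next
      fix S
      assume S: "S \<in> pairs_in_distinct_columns (pretzel_crossings h)"
      then obtain x y where xy: "S = {x, y}" "x \<noteq> y"
        by (auto simp: pairs_in_distinct_columns_def card_2_iff)
      with S have "fst x \<noteq> fst y" "x \<in> pretzel_crossings h" "y \<in> pretzel_crossings h"
        by (auto simp: pairs_in_distinct_columns_def)
      then have "(x, y) \<in> ?I \<or> (y, x) \<in> ?I"
        by auto
      then show "S \<in> (\<lambda>(x, y). {x, y}) ` ?I"
      proof
        assume "(x, y) \<in> ?I"
        then show ?thesis
          by (rule rev_image_eqI) (simp add: xy)
      next
        assume "(y, x) \<in> ?I"
        then show ?thesis
          by (rule rev_image_eqI) (simp add: xy insert_commute)
      qed
    qed
  qed
  from bij_betw_same_card[OF this] show ?thesis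
    by (simp only: card_increasing_pairs)
qed

text \<open>
  A choice counted by \<open>N1\<close> is encoded by the set \<open>S\<close> of its oriented crossings together with its
  unoriented crossing \<open>x\<close>.
\<close>
definition unoriented_patterns :: "(nat \<times> nat) set \<Rightarrow> nat \<Rightarrow> ((nat \<times> nat) set \<times> (nat \<times> nat)) set" where
  "unoriented_patterns C m = {(S, x). S \<subseteq> C \<and> x \<in> C - S \<and> card S = m - 1 \<and>
     single_curve_pattern S {x}}"

lemma mem_unoriented_patterns_iff:
  "(S, x) \<in> unoriented_patterns C m \<longleftrightarrow> S \<subseteq> C \<and> x \<in> C \<and> x \<notin> S \<and> card S = m - 1 \<and>
     inj_on fst S \<and> (card S = 2 \<or> fst x \<notin> fst ` S)"
  unfolding unoriented_patterns_def single_curve_pattern_def by blast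

lemma card_unoriented_patterns_1:
  "card (unoriented_patterns (pretzel_crossings h) 1) = h 0 + h 1 + h 2"
proof -
  let ?C = "pretzel_crossings h"
  have "S = {}" if "S \<subseteq> ?C" "card S = 1 - 1" for S
    using that finite_subset[OF that(1) finite_pretzel_crossings] by simp
  then have "unoriented_patterns ?C 1 \<subseteq> {{}} \<times> ?C"
    by (clarsimp simp only: mem_unoriented_patterns_iff mem_Times_iff fst_conv snd_conv singleton_iff simp_thms)
  moreover have "{{}} \<times> ?C \<subseteq> unoriented_patterns ?C 1"
    by (auto simp: mem_unoriented_patterns_iff)
  ultimately have "unoriented_patterns ?C 1 = {{}} \<times> ?C"
    by (rule equalityI)
  then show ?thesis
    by (simp add: card_cartesian_product card_pretzel_crossings)
qed

lemma card_unoriented_patterns_2: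
  "card (unoriented_patterns (pretzel_crossings h) 2) = 2 * (h 0 * h 1 + h 1 * h 2 + h 0 * h 2)"
proof -
  let ?C = "pretzel_crossings h"
  let ?I = "{(x, y). x \<in> ?C \<and> y \<in> ?C \<and> fst x < fst y}"
  have "unoriented_patterns ?C 2 = (\<lambda>(y, x). ({y}, x)) ` ?I \<union> (\<lambda>(x, y). ({y}, x)) ` ?I"
  proof (intro equalityI subsetI)
    fix z
    assume "z \<in> unoriented_patterns ?C 2"
    moreover obtain S x where z_eq: "z = (S, x)"
      by (cases z)
    ultimately have "x \<in> ?C" "S \<subseteq> ?C" "card S = Suc 0" "card S = 2 \<or> fst x \<notin> fst ` S"
      by (auto simp: mem_unoriented_patterns_iff)
    then obtain y where S_eq: "S = {y}" and "y \<in> ?C" "x \<in> ?C" "fst y \<noteq> fst x"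
      by (auto simp: card_Suc_eq)
    then have "(y, x) \<in> ?I \<or> (x, y) \<in> ?I"
      by (simp add: neq_iff)
    then show "z \<in> (\<lambda>(y, x). ({y}, x)) ` ?I \<union> (\<lambda>(x, y). ({y}, x)) ` ?I"
    proof (elim disjE)
      assume "(y, x) \<in> ?I"
      then show ?thesis
        by (intro UnI1 image_eqI[of _ _ "(y, x)"]) (simp_all add: z_eq S_eq)
    next
      assume "(x, y) \<in> ?I"
      then show ?thesis
        by (intro UnI2 image_eqI[of _ _ "(x, y)"]) (simp_all add: z_eq S_eq)
    qed
  qed (auto simp: mem_unoriented_patterns_iff)
  moreover have "(\<lambda>(y, x). ({y}, x)) ` ?I \<inter> (\<lambda>(x, y). ({y}, x)) ` ?I = {}"
    by auto
  moreover have "finite ?I"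
    by (rule finite_subset[of _ "?C \<times> ?C"]) (auto simp: finite_pretzel_crossings)
  moreover have "card ((\<lambda>(y, x). ({y}, x)) ` ?I) = card ?I" "card ((\<lambda>(x, y). ({y}, x)) ` ?I) = card ?I"
    by (rule card_image, auto simp: inj_on_def)+
  ultimately show ?thesis
    by (simp add: card_Un_disjoint card_increasing_pairs)
qed

text \<open>
  Once two columns are capped, one smoothing more, be it in a capped column or in the third one, does
  not close off a further curve as long as it is vertical, so \<open>x\<close> is arbitrary outside \<open>S\<close>.
\<close>
lemma card_unoriented_patterns_3:
  "card (unoriented_patterns (pretzel_crossings h) 3) =
    (h 0 * h 1 + h 1 * h 2 + h 0 * h 2) * (h 0 + h 1 + h 2 - 2)"
proof -
  let ?C = "pretzel_crossings h"
  have "unoriented_patterns ?C 3 = (SIGMA S:pairs_in_distinct_columns ?C. ?C - S)"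
    by (auto simp: mem_unoriented_patterns_iff pairs_in_distinct_columns_def)
  moreover have "card (?C - S) = h 0 + h 1 + h 2 - 2" if "S \<in> pairs_in_distinct_columns ?C" for S
    using that finite_subset[OF _ finite_pretzel_crossings, of S h]
    by (simp add: pairs_in_distinct_columns_def card_Diff_subset card_pretzel_crossings)
  moreover have "finite (pairs_in_distinct_columns ?C)"
    by (rule finite_subset[of _ "Pow ?C"])
      (auto simp: pairs_in_distinct_columns_def finite_pretzel_crossings)
  ultimately show ?thesis
    by (simp add: card_SigmaI finite_pretzel_crossings card_pairs_in_distinct_columns)
qed

text \<open>
  At least three oriented crossings would need three columns other than the column of \<open>x\<close>.
\<close>
lemma unoriented_patterns_empty:
  assumes "m > 3"
  shows "unoriented_patterns (pretzel_crossings h) m = {}"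
proof (rule ccontr)
  assume "\<not> ?thesis"
  then obtain S x where S: "S \<subseteq> pretzel_crossings h" "x \<in> pretzel_crossings h" "card S = m - 1"
    "single_curve_pattern S {x}"
    by (auto simp: unoriented_patterns_def)
  then have inj: "inj_on fst S" and x: "fst x \<notin> fst ` S"
    using assms by (auto simp: single_curve_pattern_def)
  have "fst ` S \<subseteq> {..<3}"
    using S(1) by (auto simp: pretzel_crossings_def)
  with x have sub: "fst ` S \<subseteq> {..<3} - {fst x}"
    by blast
  have "card S = card (fst ` S)"
    by (simp add: card_image inj)
  also have "\<dots> \<le> card ({..<3} - {fst x})"
    using sub by (intro card_mono) auto
  also have "\<dots> = 2"
    using S(2) by (auto simp: pretzel_crossings_def)
  finally show False
    using S(3) assms by simp
qed

lemma N0_pretzel: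
  assumes odd: "odd p" "odd q" "odd r" and ori: "orientation (pretzel p q r) ori" and m: "m \<ge> 1"
  shows "N0 (pretzel p q r) ori m =
    (if m = 2 then card (pairs_in_distinct_columns (pretzel_crossings (height p q r))) else 0)"
proof -
  let ?C = "pretzel_crossings (height p q r)"
  have "components (pretzel p q r) ori (\<lambda>x. if x \<in> S then Some Oriented else None) = 1 \<longleftrightarrow>
      card S = 2 \<and> inj_on fst S" if "S \<subseteq> ?C" "card S = m" for S
  proof -
    let ?s = "\<lambda>x. if x \<in> S then Some Oriented else None"
    have "smoothed ?s Oriented = S" "smoothed ?s Unoriented = {}" "dom ?s = S"
      by (auto simp: smoothed_def split: if_splits)
    with components_pretzel_eq_1_iff[OF odd ori, of ?s] that m show ?thesis
      by (auto simp: single_curve_pattern_def)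
  qed
  then have "N0 (pretzel p q r) ori m = card {S. S \<subseteq> ?C \<and> card S = m \<and> card S = 2 \<and> inj_on fst S}"
    unfolding N0_def crossings_pretzel by (metis (no_types, lifting))
  also have "{S. S \<subseteq> ?C \<and> card S = m \<and> card S = 2 \<and> inj_on fst S} =
      (if m = 2 then pairs_in_distinct_columns ?C else {})"
    by (auto simp: pairs_in_distinct_columns_def)
  finally show ?thesis
    by simp
qed

lemma N1_pretzel:
  assumes odd: "odd p" "odd q" "odd r" and ori: "orientation (pretzel p q r) ori" and m: "m \<ge> 1"
  shows "N1 (pretzel p q r) ori m = card (unoriented_patterns (pretzel_crossings (height p q r)) m)"
proof -
  let ?C = "pretzel_crossings (height p q r)"
  let ?A = "{s. dom s \<subseteq> ?C \<and> card (dom s) = m \<and> card {x. s x = Some Unoriented} = 1 \<and>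
     card {x. s x = Some Oriented} = m - 1 \<and> components (pretzel p q r) ori s = 1}"
  let ?f = "\<lambda>(S, x) y. if y = x then Some Unoriented else if y \<in> S then Some Oriented else None"
  have "bij_betw ?f (unoriented_patterns ?C m) ?A"
  proof (rule bij_betw_imageI)
    show "inj_on ?f (unoriented_patterns ?C m)"
    proof (rule inj_onI)
      fix z w
      assume z: "z \<in> unoriented_patterns ?C m" and w: "w \<in> unoriented_patterns ?C m"
        and eq: "?f z = ?f w"
      have mem: "smoothed (?f z) Oriented = fst z \<and> smoothed (?f z) Unoriented = {snd z}"
        if "z \<in> unoriented_patterns ?C m" for z
        using that by (auto simp: smoothed_def unoriented_patterns_def split: if_splits)
      show "z = w"
        using mem[OF z] mem[OF w] eq by (metis prod_eqI singleton_inject)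
    qed
    show "?f ` unoriented_patterns ?C m = ?A"
    proof (intro equalityI subsetI)
      fix s
      assume "s \<in> ?f ` unoriented_patterns ?C m"
      then obtain S x where s: "s = ?f (S, x)" and S: "(S, x) \<in> unoriented_patterns ?C m"
        by auto
      then have Sx: "S \<subseteq> ?C" "x \<in> ?C" "x \<notin> S" "card S = m - 1" "single_curve_pattern S {x}"
        by (auto simp: unoriented_patterns_def)
      have fin: "finite S"
        using Sx(1) finite_pretzel_crossings by (rule finite_subset)
      have sm: "smoothed s Oriented = S" "smoothed s Unoriented = {x}"
        using Sx by (auto simp: s smoothed_def split: if_splits)
      have dom: "dom s = insert x S"
        unfolding dom_smoothed sm by simp
      have "components (pretzel p q r) ori s = 1"
        using components_pretzel_eq_1_iff[OF odd ori, of s] sm dom Sx by auto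
      then show "s \<in> ?A"
        using sm Sx fin m by (auto simp: smoothed_def dom)
    next
      fix s
      assume s: "s \<in> ?A"
      then obtain x where x: "smoothed s Unoriented = {x}"
        by (auto simp: smoothed_def card_1_singleton_iff)
      let ?S = "smoothed s Oriented"
      have disj: "x \<notin> ?S"
        using x unfolding smoothed_def by force
      have sub: "?S \<subseteq> ?C" "x \<in> ?C"
        using s x dom_smoothed[of s] by auto
      have "single_curve_pattern ?S {x}"
        using components_pretzel_eq_1_iff[OF odd ori, of s] s x by auto
      then have mem: "(?S, x) \<in> unoriented_patterns ?C m"
        using sub disj s by (auto simp: unoriented_patterns_def smoothed_def)
      have eq: "?f (?S, x) = s"
      proof
        fix y
        have "s y = None \<or> s y = Some Oriented \<or> s y = Some Unoriented"
          by (metis option.exhaust smoothing.exhaust)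
        moreover have "s y = Some Unoriented \<longleftrightarrow> y = x"
          using x by (auto simp: smoothed_def)
        ultimately show "?f (?S, x) y = s y"
          by (auto simp: smoothed_def)
      qed
      show "s \<in> ?f ` unoriented_patterns ?C m"
        using mem by (rule rev_image_eqI) (rule eq[symmetric])
    qed
  qed
  from bij_betw_same_card[OF this] show ?thesis
    by (simp only: N1_def crossings_pretzel)
qed

theorem theorem18:
  fixes p q r :: int and P Q R m :: nat and ori :: "(nat \<times> nat) \<times> corner \<Rightarrow> bool"
  assumes "odd p" and "odd q" and "odd r"
    and "P = nat \<bar>p\<bar>" and "Q = nat \<bar>q\<bar>" and "R = nat \<bar>r\<bar>"
    and "m \<ge> 1"
    and "orientation (pretzel p q r) ori"
  shows "N0 (pretzel p q r) ori m = (if m = 2 then P * Q + Q * R + P * R else 0) \<and>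
    N1 (pretzel p q r) ori m =
      (if m = 1 then P + Q + R
       else if m = 2 then 2 * (P * Q + Q * R + P * R)
       else if m = 3 then 3 * P * Q * R + 2 * (P choose 2) * (Q + R)
         + 2 * (Q choose 2) * (P + R) + 2 * (R choose 2) * (P + Q)
       else 0)"
proof
  let ?h = "height p q r"
  note N0 = N0_pretzel[OF assms(1-3,8,7)] and N1 = N1_pretzel[OF assms(1-3,8,7)]
  have h: "?h 0 = P" "?h 1 = Q" "?h 2 = R"
    using assms(4-6) by (simp_all add: height_def twist_def numeral_2_eq_2)
  show "N0 (pretzel p q r) ori m = (if m = 2 then P * Q + Q * R + P * R else 0)"
    using card_pairs_in_distinct_columns[of ?h] unfolding N0 h by simp
  have "P > 0" "Q > 0" "R > 0"
    using assms(1-6) by auto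
  then obtain a b c where abc: "P = Suc a" "Q = Suc b" "R = Suc c"
    by (metis gr0_implies_Suc)
  have choose: "2 * (Suc n choose 2) = Suc n * n" for n :: nat
    by (simp add: choose_two)
  \<comment> \<open>Writing the numbers as successors removes the subtractions in \<open>P + Q + R - 2\<close> and \<open>P (P - 1)\<close>.\<close>
  have count_3: "(P * Q + Q * R + P * R) * (P + Q + R - 2) =
      3 * P * Q * R + 2 * (P choose 2) * (Q + R) + 2 * (Q choose 2) * (P + R) +
      2 * (R choose 2) * (P + Q)"
    unfolding abc choose by (simp add: algebra_simps)
  consider "m = 1" | "m = 2" | "m = 3" | "m > 3"
    using assms(7) by linarith
  then show "N1 (pretzel p q r) ori m =
      (if m = 1 then P + Q + R
       else if m = 2 then 2 * (P * Q + Q * R + P * R)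
       else if m = 3 then 3 * P * Q * R + 2 * (P choose 2) * (Q + R)
         + 2 * (Q choose 2) * (P + R) + 2 * (R choose 2) * (P + Q)
       else 0)"
  proof cases
    case 1
    then show ?thesis
      using card_unoriented_patterns_1[of ?h] unfolding N1 h by simp
  next
    case 2
    then show ?thesis
      using card_unoriented_patterns_2[of ?h] unfolding N1 h by simp
  next
    case 3
    then show ?thesis
      using card_unoriented_patterns_3[of ?h] count_3 unfolding N1 h by simp
  next
    case 4
    then show ?thesis
      by (simp add: N1 unoriented_patterns_empty)
  qed
qed

end
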